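(* Let $S, T, F$ be semigroups, and let $\varphi : S \to F$, $\psi : T \to F$ be epimorphisms. If the fiber product $\Pi(\varphi,\psi) = \{(s,t) \in S\times T : \varphi(s) = \psi(t)\}$ is finitely generated, then $S$, $T$ and $F$ are finitely generated.
   Context: "Epimorphism" means surjective homomorphism. $\Pi(\varphi,\psi)$ is a subsemigroup of the direct product $S \times T$. A semigroup is finitely generated if it has a finite subset such that every element is a finite product of elements of that subset. *)

theory Defs
  imports "HOL-Algebra.Group"
begin

text \<open>
  Semigroups are carried by the records of HOL-Algebra, so that its \<^const>\<open>epi\<close> and
  \<^const>\<open>DirProd\<close> apply. The field \<^const>\<open>one\<close> is unconstrained and plays no role.
  The name avoids a clash with the type-based locale \<open>semigroup\<close> of HOL.
\<close>

locale alg_semigroup =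
  fixes S (structure)
  assumes m_closed: "\<lbrakk>x \<in> carrier S; y \<in> carrier S\<rbrakk> \<Longrightarrow> x \<otimes> y \<in> carrier S"
    and m_assoc: "\<lbrakk>x \<in> carrier S; y \<in> carrier S; z \<in> carrier S\<rbrakk>
      \<Longrightarrow> (x \<otimes> y) \<otimes> z = x \<otimes> (y \<otimes> z)"

definition fiber_product ::
  "('a, 'm) monoid_scheme \<Rightarrow> ('b, 'n) monoid_scheme \<Rightarrow> ('a \<Rightarrow> 'c) \<Rightarrow> ('b \<Rightarrow> 'c) \<Rightarrow> ('a \<times> 'b) monoid"
  where "fiber_product S T \<phi> \<psi> =
    (S \<times>\<times> T)\<lparr>carrier := {(s, t). s \<in> carrier S \<and> t \<in> carrier T \<and> \<phi> s = \<psi> t}\<rparr>"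

text \<open>
  For want of an identity a product needs at least one factor: \<open>semigroup_prod S a [b\<^sub>1, \<dots>, b\<^sub>k]\<close>
  is the product of the \<open>k + 1\<close> factors \<open>a, b\<^sub>1, \<dots>, b\<^sub>k\<close>.
\<close>

definition semigroup_prod :: "('a, 'm) monoid_scheme \<Rightarrow> 'a \<Rightarrow> 'a list \<Rightarrow> 'a"
  where "semigroup_prod S a bs = foldl (mult S) a bs"

definition finitely_generated :: "('a, 'm) monoid_scheme \<Rightarrow> bool"
  where "finitely_generated S \<longleftrightarrow>
    (\<exists>A. finite A \<and> A \<subseteq> carrier S \<and>
      (\<forall>x\<in>carrier S. \<exists>a\<in>A. \<exists>bs\<in>lists A. x = semigroup_prod S a bs))"

lemma alg_semigroup_fiber_product:
  assumes S: "alg_semigroup S" and T: "alg_semigroup T"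
    and hom: "\<phi> \<in> hom S F" "\<psi> \<in> hom T F"
  shows "alg_semigroup (fiber_product S T \<phi> \<psi>)"
  using hom alg_semigroup.m_closed[OF S] alg_semigroup.m_closed[OF T]
    alg_semigroup.m_assoc[OF S] alg_semigroup.m_assoc[OF T]
  by unfold_locales (auto simp: fiber_product_def DirProd_def hom_def)

end

theory Submission
  imports Defs
begin

text \<open>
  An epimorphic image of a finitely generated semigroup is finitely generated: the images of the
  generators generate (\<open>finitely_generated_epi_image\<close>). Both coordinate projections of the fiber
  product are epimorphisms. For a given \<open>s\<close>, surjectivity of \<open>\<psi>\<close> provides some \<open>t\<close> with
  \<open>\<phi> s = \<psi> t\<close>, so that \<open>s\<close> is the first coordinate of the element \<open>(s, t)\<close>; the argument for \<open>T\<close>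
  uses surjectivity of \<open>\<phi>\<close> in the same way. Finally, \<open>F\<close> is the image of \<open>S\<close> under \<open>\<phi>\<close>.
\<close>

lemma hom_semigroup_prod:
  assumes P: "alg_semigroup P" and h: "h \<in> hom P Q"
    and "a \<in> carrier P" and "set bs \<subseteq> carrier P"
  shows "h (semigroup_prod P a bs) = semigroup_prod Q (h a) (map h bs)"
  using assms(3,4)
proof (induction bs arbitrary: a)
  case Nil
  then show ?case by (simp add: semigroup_prod_def)
next
  case (Cons b bs)
  \<comment> \<open>The accumulator \<open>a\<close> is general, so the first two factors merge into one.\<close>
  have "h (semigroup_prod P (a \<otimes>\<^bsub>P\<^esub> b) bs) = semigroup_prod Q (h (a \<otimes>\<^bsub>P\<^esub> b)) (map h bs)"
    using Cons alg_semigroup.m_closed[OF P] by simp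
  moreover have "h (a \<otimes>\<^bsub>P\<^esub> b) = h a \<otimes>\<^bsub>Q\<^esub> h b"
    using Cons.prems hom_mult[OF h] by simp
  ultimately show ?case by (simp add: semigroup_prod_def)
qed

lemma finitely_generated_epi_image:
  assumes P: "alg_semigroup P" and h: "h \<in> epi P Q" and fg: "finitely_generated P"
  shows "finitely_generated Q"
proof -
  from h have hom: "h \<in> hom P Q" and surj: "h ` carrier P = carrier Q"
    by (auto simp: epi_def)
  from fg obtain A where A: "finite A" "A \<subseteq> carrier P"
    and gen: "\<And>x. x \<in> carrier P \<Longrightarrow> \<exists>a\<in>A. \<exists>bs\<in>lists A. x = semigroup_prod P a bs"
    unfolding finitely_generated_def by auto
  have "\<exists>a\<in>h ` A. \<exists>bs\<in>lists (h ` A). y = semigroup_prod Q a bs" if "y \<in> carrier Q" for y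
  proof -
    from that surj obtain x where x: "x \<in> carrier P" "y = h x" by auto
    from gen[OF x(1)] obtain a bs
      where ab: "a \<in> A" "bs \<in> lists A" "x = semigroup_prod P a bs" by auto
    have "y = semigroup_prod Q (h a) (map h bs)"
      using ab A(2) x(2) hom_semigroup_prod[OF P hom, of a bs] by auto
    moreover have "map h bs \<in> lists (h ` A)"
      using ab(2) by auto
    ultimately show ?thesis using ab(1) by blast
  qed
  moreover have "finite (h ` A)" "h ` A \<subseteq> carrier Q"
    using A surj by auto
  ultimately show ?thesis unfolding finitely_generated_def by blast
qed

lemma fst_epi_fiber_product:
  assumes \<phi>: "\<phi> ` carrier S \<subseteq> carrier F" and \<psi>: "carrier F \<subseteq> \<psi> ` carrier T"
  shows "fst \<in> epi (fiber_product S T \<phi> \<psi>) S"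
proof -
  have "s \<in> fst ` carrier (fiber_product S T \<phi> \<psi>)" if s: "s \<in> carrier S" for s
  proof -
    from s \<phi> \<psi> obtain t where "t \<in> carrier T" "\<phi> s = \<psi> t" by blast
    with s show ?thesis by (force simp: fiber_product_def)
  qed
  then show ?thesis
    by (auto simp: epi_def hom_def fiber_product_def DirProd_def)
qed

lemma snd_epi_fiber_product:
  assumes \<phi>: "carrier F \<subseteq> \<phi> ` carrier S" and \<psi>: "\<psi> ` carrier T \<subseteq> carrier F"
  shows "snd \<in> epi (fiber_product S T \<phi> \<psi>) T"
proof -
  have "t \<in> snd ` carrier (fiber_product S T \<phi> \<psi>)" if t: "t \<in> carrier T" for t
  proof -
    from t \<phi> \<psi> obtain s where "s \<in> carrier S" "\<psi> t = \<phi> s" by blast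
    with t show ?thesis by (force simp: fiber_product_def)
  qed
  then show ?thesis
    by (auto simp: epi_def hom_def fiber_product_def DirProd_def)
qed

theorem lemma4p1:
  fixes S :: "('a, 'm) monoid_scheme"
    and T :: "('b, 'n) monoid_scheme"
    and F :: "('c, 'k) monoid_scheme"
    and \<phi> :: "'a \<Rightarrow> 'c" and \<psi> :: "'b \<Rightarrow> 'c"
  assumes "alg_semigroup S" and "alg_semigroup T" and "alg_semigroup F"
    and "\<phi> \<in> epi S F" and "\<psi> \<in> epi T F"
    and "finitely_generated (fiber_product S T \<phi> \<psi>)"
  shows "finitely_generated S \<and> finitely_generated T \<and> finitely_generated F"
proof -
  have hom: "\<phi> \<in> hom S F" "\<psi> \<in> hom T F"
    and surj: "\<phi> ` carrier S = carrier F" "\<psi> ` carrier T = carrier F"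
    using assms(4,5) by (auto simp: epi_def)
  have P: "alg_semigroup (fiber_product S T \<phi> \<psi>)"
    using alg_semigroup_fiber_product[OF assms(1,2) hom] .
  have "fst \<in> epi (fiber_product S T \<phi> \<psi>) S"
    by (rule fst_epi_fiber_product[where F = F]) (simp_all add: surj)
  then have S: "finitely_generated S"
    by (rule finitely_generated_epi_image[OF P _ assms(6)])
  have "snd \<in> epi (fiber_product S T \<phi> \<psi>) T"
    by (rule snd_epi_fiber_product[where F = F]) (simp_all add: surj)
  then have T: "finitely_generated T"
    by (rule finitely_generated_epi_image[OF P _ assms(6)])
  have "finitely_generated F"
    by (rule finitely_generated_epi_image[OF assms(1,4) S])
  with S T show ?thesis by simp
qed

end
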